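(* Let $\mathbb{X}$ be a linearly ordered radicable idempotent semifield, let $n\ge1$, let $A\in\mathbb{X}^{n\times n}$ be an arbitrary matrix and $b\in\mathbb{X}^{n}$ a vector. Consider the inequality $$Ax\oplus b\le x$$ in the unknown regular vector $x\in\mathbb{X}_{+}^{n}$. Then: 1. If $\operatorname{Tr}(A)\le\mathbb{1}$, then a regular vector $x$ satisfies the inequality if and only if $x=A^{\ast}u$ for some regular vector $u\in\mathbb{X}_{+}^{n}$ with $u\ge b$ (in other words, the complete regular solution is $x=A^{\ast}u$ for all regular $u\ge b$). 2. If $\operatorname{Tr}(A)>\mathbb{1}$, then there is no regular solution.
   Context: A linearly ordered radicable idempotent semifield is a set $\mathbb{X}$ with two associative, commutative operations $\oplus$ (addition, neutral element $\mathbb{0}$) and $\otimes$ (multiplication, neutral element $\mathbb{1}$, sign omitted), with multiplication distributive over addition, $\mathbb{0}$ absorbing for multiplication, $\mathbb{0}\ne\mathbb{1}$, such that: $x\oplus x=x$ for all $x$; every $x\in\mathbb{X}_{+}=\mathbb{X}\setminus\{\mathbb{0}\}$ has a multiplicative inverse $x^{-1}$; the order defined by $x\le y\iff x\oplus y=y$ is total; and for every $x\in\mathbb{X}$ and integer $p\ge1$ there is a (then unique) $x^{1/p}$ with $(x^{1/p})^{p}=x$ (so rational powers are defined, $\mathbb{0}^{1/p}=\mathbb{0}$). Example: $(\mathbb{R}\cup\{-\infty\},\max,+)$ with $\mathbb{0}=-\infty$, $\mathbb{1}=0$. Vectors and matrices over $\mathbb{X}$ are added, multiplied, and scaled by the usual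 formulas with $\oplus,\otimes$ in place of $+,\times$; inequalities between vectors are component-wise. $I$ is the identity matrix ($\mathbb{1}$ on the diagonal, $\mathbb{0}$ elsewhere), $A^{0}=I$, $A^{p}=A^{p-1}A$. A vector is regular if all its components are different from $\mathbb{0}$; $\mathbb{X}_{+}^{n}$ is the set of regular vectors. For $A\in\mathbb{X}^{n\times n}$: $\operatorname{tr}A=a_{11}\oplus\cdots\oplus a_{nn}$; $\operatorname{Tr}(A)=\operatorname{tr}A\oplus\operatorname{tr}A^{2}\oplus\cdots\oplus\operatorname{tr}A^{n}$; $A^{\ast}=I\oplus A\oplus\cdots\oplus A^{n-1}$. *)

theory Defs
  imports "HOL-Analysis.Analysis"
begin

text \<open>
  Addition and multiplication of the semifield are the class operations \<open>+\<close>, \<open>*\<close> with neutral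
  elements \<open>0\<close>, \<open>1\<close>; in max-plus algebra, for instance, \<open>+\<close> is the maximum and \<open>*\<close> the usual sum.
  The axiom \<open>le_iff_plus\<close> says that the linear order is the one induced by idempotent addition.
\<close>

class radicable_idem_semifield = comm_semiring_1 + linorder +
  assumes plus_idem: "x + x = x"
    and ex_mult_inverse: "x \<noteq> 0 \<Longrightarrow> \<exists>y. x * y = 1"
    and le_iff_plus: "x \<le> y \<longleftrightarrow> x + y = y"
    and ex_root: "p \<ge> 1 \<Longrightarrow> \<exists>y. y ^ p = x"

text \<open>
  The library instances of \<open>*\<close>, \<open>1\<close> and \<open>^\<close> on the type \<open>vec\<close> are component-wise, so powers of
  matrices have to be defined from the matrix product.
\<close>

primrec matpow :: "'a::semiring_1^'n^'n \<Rightarrow> nat \<Rightarrow> 'a^'n^'n" where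
  "matpow A 0 = mat 1"
| "matpow A (Suc p) = matpow A p ** A"

definition Tr :: "'a::semiring_1^'n^'n \<Rightarrow> 'a" where
  "Tr A = (\<Sum>p = 1..CARD('n). trace (matpow A p))"

definition mat_star :: "'a::semiring_1^'n^'n \<Rightarrow> 'a^'n^'n" where
  "mat_star A = (\<Sum>p<CARD('n). matpow A p)"

definition regular :: "'a::zero^'n \<Rightarrow> bool" where
  "regular x \<longleftrightarrow> (\<forall>i. x $ i \<noteq> 0)"

end

theory Submission
  imports Defs
begin

text \<open>
  Write the entries of \<open>A\<^sup>p\<close> as maxima of weights of walks of length \<open>p\<close>. A walk with \<open>CARD('n)\<close>
  steps visits some index twice, and if \<open>Tr A \<le> 1\<close> then cutting out the cycle in between does not
  decrease its weight. Hence \<open>A\<^sup>n \<le> A\<^sup>*\<close>, so \<open>A A\<^sup>* \<le> A\<^sup>*\<close> and every \<open>A\<^sup>* u\<close> is a solution.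
  Conversely \<open>A x \<le> x\<close> implies \<open>A\<^sup>p x \<le> x\<close> for all \<open>p\<close>, so that \<open>A\<^sup>* x = x\<close>; and if \<open>x\<close> is regular,
  cancelling \<open>x\<^sub>i\<close> shows that the diagonal entries of \<open>A\<^sup>p\<close> are at most \<open>1\<close>, so \<open>Tr A \<le> 1\<close>.
\<close>

\<comment> \<open>Order structure of the semifield; finite sums as maxima\<close>
subclass (in radicable_idem_semifield) canonically_ordered_monoid_add
proof
  fix a b :: 'a
  show "a \<le> b \<longleftrightarrow> (\<exists>c. b = a + c)"
    by (metis le_iff_plus plus_idem add.assoc)
qed

\<comment> \<open>Distributivity carries \<open>a + b = b\<close> over to
  \<open>c * a + c * b = c * b\<close>. As \<open>0\<close> is the least element, no sign condition
  on \<open>c\<close> arises in monotonicity arguments.\<close>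
subclass (in radicable_idem_semifield) ordered_comm_semiring
proof
  fix a b c :: 'a
  assume "a \<le> b"
  then show "c * a \<le> c * b"
    by (metis le_iff_plus distrib_left)
qed

lemma plus_eq_max: "x + y = max x (y :: 'a::radicable_idem_semifield)"
  by (metis le_iff_plus add.commute max_def linear)

lemma sum_le_iff:
  fixes f :: "'b \<Rightarrow> 'a::radicable_idem_semifield"
  assumes "finite S"
  shows "sum f S \<le> c \<longleftrightarrow> (\<forall>i\<in>S. f i \<le> c)"
  using assms by induction (auto simp: plus_eq_max)

lemma sum_attained:
  fixes f :: "'b \<Rightarrow> 'a::radicable_idem_semifield"
  assumes "finite S" "S \<noteq> {}"
  shows "\<exists>i\<in>S. sum f S = f i"
  using assms by (induction rule: finite_ne_induct) (auto simp: plus_eq_max max_def)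

lemma mult_le_cancel_nonzero:
  fixes a c :: "'a::radicable_idem_semifield"
  assumes "c \<noteq> 0" "a * c \<le> c"
  shows "a \<le> 1"
proof -
  obtain d where d: "c * d = 1"
    using ex_mult_inverse assms(1) by blast
  have "a * c * d \<le> c * d"
    by (rule mult_right_mono) (use assms in auto)
  then show ?thesis
    by (simp add: d mult.assoc)
qed

section \<open>Matrix powers and weights of walks\<close>

lemma matpow_add: "matpow A (p + q) = matpow A p ** matpow A q"
  by (induction q) (simp_all add: matrix_mul_assoc)

lemma matpow_mult_le:
  fixes A :: "'a::radicable_idem_semifield^'n^'n"
  shows "matpow A p $ i $ k * matpow A q $ k $ j \<le> matpow A (p + q) $ i $ j"
  unfolding matpow_add matrix_matrix_mult_def
  by (simp add: member_le_sum[where f = "\<lambda>k. matpow A p $ i $ k * matpow A q $ k $ j"])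

text \<open>The weight of a single walk is one of the terms maximised in the matrix entry. The
  offset \<open>s\<close> lets the bound apply to any segment of a longer walk without
  reindexing.\<close>

lemma walk_weight_le_matpow:
  fixes A :: "'a::radicable_idem_semifield^'n^'n"
  shows "(\<Prod>k = s..<s + p. A $ w k $ w (Suc k)) \<le> matpow A p $ w s $ w (s + p)"
proof (induction p)
  case 0
  then show ?case by (simp add: mat_def)
next
  case (Suc p)
  have "(\<Prod>k = s..<s + Suc p. A $ w k $ w (Suc k))
      = (\<Prod>k = s..<s + p. A $ w k $ w (Suc k)) * A $ w (s + p) $ w (Suc (s + p))"
    by simp
  also have "\<dots> \<le> matpow A p $ w s $ w (s + p) * matpow A 1 $ w (s + p) $ w (Suc (s + p))"
    by (simp add: mult_right_mono Suc.IH)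
  also have "\<dots> \<le> matpow A (p + 1) $ w s $ w (Suc (s + p))"
    by (rule matpow_mult_le)
  finally show ?case by simp
qed

text \<open>Since the order is total, the maximum over the last intermediate index is attained, and
  an optimal walk can be traced back. Length 0 is excluded: for \<open>i \<noteq> j\<close> no such
  walk exists.\<close>

lemma ex_optimal_walk:
  fixes A :: "'a::radicable_idem_semifield^'n^'n"
  shows "\<exists>w. w 0 = i \<and> matpow A (Suc p) $ i $ j = (\<Prod>k<Suc p. A $ w k $ w (Suc k)) \<and> w (Suc p) = j"
proof (induction p arbitrary: j)
  case 0
  show ?case
    by (rule exI[of _ "\<lambda>k. if k = 0 then i else j"]) simp
next
  case (Suc p)
  obtain l where l: "matpow A (Suc (Suc p)) $ i $ j = matpow A (Suc p) $ i $ l * A $ l $ j"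
    using sum_attained[of UNIV "\<lambda>l. matpow A (Suc p) $ i $ l * A $ l $ j"]
    by (auto simp: matrix_matrix_mult_def simp del: matpow.simps(2)
             simp add: matpow.simps(2)[of A "Suc p"])
  obtain w where w: "w 0 = i" "w (Suc p) = l"
    "matpow A (Suc p) $ i $ l = (\<Prod>k<Suc p. A $ w k $ w (Suc k))"
    using Suc.IH by blast
  \<comment> \<open>The walk to \<open>l\<close> is extended by the edge from \<open>l\<close> to
    \<open>j\<close>; its earlier positions are unchanged.\<close>
  define v where "v = w(Suc (Suc p) := j)"
  have "(\<Prod>k<Suc p. A $ v k $ v (Suc k)) = (\<Prod>k<Suc p. A $ w k $ w (Suc k))"
    by (rule prod.cong) (auto simp: v_def)
  then have "matpow A (Suc (Suc p)) $ i $ j = (\<Prod>k<Suc (Suc p). A $ v k $ v (Suc k))"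
    unfolding l w(3) prod.lessThan_Suc[of _ "Suc p"] by (simp add: v_def w(2))
  then show ?case
    using w(1) by (intro exI[of _ v]) (simp add: v_def)
qed

lemma matpow_diag_le_Tr:
  fixes A :: "'a::radicable_idem_semifield^'n^'n"
  assumes "1 \<le> p" "p \<le> CARD('n)"
  shows "matpow A p $ i $ i \<le> Tr A"
proof -
  have "matpow A p $ i $ i \<le> trace (matpow A p)"
    unfolding trace_def by (rule member_le_sum) auto
  also have "\<dots> \<le> Tr A"
    unfolding Tr_def by (rule member_le_sum) (use assms in auto)
  finally show ?thesis .
qed

lemma matpow_le_mat_star:
  fixes A :: "'a::radicable_idem_semifield^'n^'n"
  assumes "p < CARD('n)"
  shows "matpow A p $ i $ j \<le> mat_star A $ i $ j"
  unfolding mat_star_def sum_component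
  by (rule member_le_sum) (use assms in auto)

lemma matpow_card_le_mat_star:
  fixes A :: "'a::radicable_idem_semifield^'n^'n"
  assumes "Tr A \<le> 1"
  shows "matpow A CARD('n) $ i $ j \<le> mat_star A $ i $ j"
proof -
  define n where "n = CARD('n)"
  have n: "n = Suc (n - 1)"
    by (simp add: n_def)
  obtain w where w: "w 0 = i" "w n = j"
    "matpow A n $ i $ j = (\<Prod>k<n. A $ w k $ w (Suc k))"
    using ex_optimal_walk[of i A "n - 1" j] n by auto
  \<comment> \<open>Pigeonhole: \<open>n + 1\<close> positions, but only \<open>n\<close>
    indices.\<close>
  have "\<not> inj_on w {..n}"
    using card_inj_on_le[of w "{..n}" UNIV] by (auto simp: n_def)
  then obtain s t where st: "s < t" "t \<le> n" "w s = w t"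
    unfolding inj_on_def by (metis atMost_iff linorder_neqE_nat)
  let ?W = "\<lambda>S. \<Prod>k\<in>S. A $ w k $ w (Suc k)"
  \<comment> \<open>The middle segment is a cycle of length between 1 and \<open>n\<close>, so its
    weight is bounded by \<open>Tr A\<close>.\<close>
  have "matpow A n $ i $ j = ?W {0..<s} * ?W {s..<t} * ?W {t..<n}"
    using st by (simp add: w(3) prod.atLeastLessThan_concat flip: atLeast0LessThan)
  also have "\<dots> \<le> ?W {0..<s} * 1 * ?W {t..<n}"
  proof (intro mult_right_mono mult_left_mono)
    have "?W {s..<t} \<le> matpow A (t - s) $ w s $ w s"
      using walk_weight_le_matpow[of A w s "t - s"] st by simp
    also have "\<dots> \<le> Tr A"
      by (rule matpow_diag_le_Tr) (use st in \<open>auto simp: n_def\<close>)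
    finally show "?W {s..<t} \<le> 1"
      using assms by simp
  qed auto
  \<comment> \<open>Because \<open>w s = w t\<close>, the outer segments join to a walk of length
    \<open>s + (n - t) < n\<close>, which the star covers.\<close>
  also have "\<dots> \<le> matpow A s $ i $ w s * matpow A (n - t) $ w s $ j"
    using walk_weight_le_matpow[of A w 0 s] walk_weight_le_matpow[of A w t "n - t"] st w
    by (simp add: mult_mono)
  also have "\<dots> \<le> matpow A (s + (n - t)) $ i $ j"
    by (rule matpow_mult_le)
  also have "\<dots> \<le> mat_star A $ i $ j"
    by (rule matpow_le_mat_star) (use st in \<open>auto simp: n_def\<close>)
  finally show ?thesis
    by (simp add: n_def)
qed

section \<open>Matrix-vector inequalities and the action of the star\<close>

lemma matrix_vector_mult_le_iff:
  fixes A :: "'a::radicable_idem_semifield^'n^'m"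
  shows "A *v x \<le> y \<longleftrightarrow> (\<forall>i j. A $ i $ j * x $ j \<le> y $ i)"
  by (simp add: less_eq_vec_def matrix_vector_mult_def sum_le_iff)

lemma plus_vec_le_iff:
  fixes x y z :: "'a::radicable_idem_semifield^'n"
  shows "x + y \<le> z \<longleftrightarrow> x \<le> z \<and> y \<le> z"
  by (auto simp: less_eq_vec_def plus_eq_max)

lemma matrix_vector_mult_mono:
  fixes A :: "'a::radicable_idem_semifield^'n^'m"
  assumes "x \<le> y"
  shows "A *v x \<le> A *v y"
  using assms unfolding less_eq_vec_def matrix_vector_mult_def
  by (auto intro!: sum_mono mult_left_mono)

lemma matpow_vector_le:
  fixes A :: "'a::radicable_idem_semifield^'n^'n"
  assumes "A *v x \<le> x"
  shows "matpow A p *v x \<le> x"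
proof (induction p)
  case 0
  then show ?case by simp
next
  case (Suc p)
  have "matpow A (Suc p) *v x = matpow A p *v (A *v x)"
    by (simp add: matrix_vector_mul_assoc)
  also have "\<dots> \<le> matpow A p *v x"
    by (rule matrix_vector_mult_mono) (rule assms)
  finally show ?case
    using Suc by simp
qed

text \<open>The identity matrix is the term \<open>p = 0\<close> of the star.\<close>

lemma le_mat_star_vector:
  fixes A :: "'a::radicable_idem_semifield^'n^'n"
  shows "u \<le> mat_star A *v u"
  unfolding less_eq_vec_def
proof
  fix i
  have "matpow A 0 $ i $ i * u $ i \<le> mat_star A $ i $ i * u $ i"
    by (intro mult_right_mono matpow_le_mat_star) auto
  then have "u $ i \<le> mat_star A $ i $ i * u $ i"
    by (simp add: mat_def)
  also have "\<dots> \<le> (mat_star A *v u) $ i"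
    using matrix_vector_mult_le_iff[of "mat_star A" u "mat_star A *v u"] by simp
  finally show "u $ i \<le> (mat_star A *v u) $ i" .
qed

lemma mat_star_vector_eq:
  fixes A :: "'a::radicable_idem_semifield^'n^'n"
  assumes "A *v x \<le> x"
  shows "mat_star A *v x = x"
proof (rule antisym)
  show "mat_star A *v x \<le> x"
    using matpow_vector_le[OF assms]
    by (simp add: matrix_vector_mult_le_iff mat_star_def sum_component sum_distrib_right sum_le_iff)
  show "x \<le> mat_star A *v x"
    by (rule le_mat_star_vector)
qed

lemma mult_mat_star_le:
  fixes A :: "'a::radicable_idem_semifield^'n^'n"
  assumes "Tr A \<le> 1"
  shows "A $ i $ k * mat_star A $ k $ j \<le> mat_star A $ i $ j"
proof -
  have "A $ i $ k * matpow A p $ k $ j \<le> mat_star A $ i $ j" if "p < CARD('n)" for p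
  proof -
    have "A $ i $ k * matpow A p $ k $ j \<le> matpow A (Suc p) $ i $ j"
      using matpow_mult_le[of A 1 i k p j] by simp
    also have "\<dots> \<le> mat_star A $ i $ j"
    \<comment> \<open>Multiplication by \<open>A\<close> raises each exponent by one; only the top
      power of the star leaves its range, and there the cycle argument is needed.\<close>
    proof (cases "Suc p = CARD('n)")
      case True
      then show ?thesis
        using matpow_card_le_mat_star[OF assms] by metis
    next
      case False
      then show ?thesis
        using that by (intro matpow_le_mat_star) simp
    qed
    finally show ?thesis .
  qed
  then show ?thesis
    by (subst mat_star_def) (simp add: sum_component sum_distrib_left sum_le_iff)
qed

lemma matrix_mat_star_vector_le:
  fixes A :: "'a::radicable_idem_semifield^'n^'n"
  assumes "Tr A \<le> 1"
  shows "A *v (mat_star A *v u) \<le> mat_star A *v u"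
proof -
  have "(A ** mat_star A) $ i $ j \<le> mat_star A $ i $ j" for i j
    by (simp add: matrix_matrix_mult_def sum_le_iff mult_mat_star_le[OF assms])
  then show ?thesis
    unfolding matrix_vector_mul_assoc less_eq_vec_def
    by (auto simp: matrix_vector_mult_def intro!: sum_mono mult_right_mono)
qed

lemma Tr_le_one:
  fixes A :: "'a::radicable_idem_semifield^'n^'n"
  assumes "regular x" "A *v x \<le> x"
  shows "Tr A \<le> 1"
proof -
  have "matpow A p $ i $ i \<le> 1" for p i
  proof (rule mult_le_cancel_nonzero)
    show "x $ i \<noteq> 0"
      using assms(1) by (simp add: regular_def)
    \<comment> \<open>This is the diagonal term of component \<open>i\<close> of
      \<open>matpow A p *v x \<le> x\<close>.\<close>
    show "matpow A p $ i $ i * x $ i \<le> x $ i"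
      using matpow_vector_le[OF assms(2)] by (simp add: matrix_vector_mult_le_iff)
  qed
  then show ?thesis
    by (simp add: Tr_def trace_def sum_le_iff)
qed

theorem theorem2:
  fixes A :: "'a::radicable_idem_semifield^'n^'n" and b :: "'a^'n"
  shows "(Tr A \<le> 1 \<longrightarrow>
           (\<forall>x. regular x \<longrightarrow>
             (A *v x + b \<le> x \<longleftrightarrow> (\<exists>u. regular u \<and> b \<le> u \<and> x = mat_star A *v u)))) \<and>
         (Tr A > 1 \<longrightarrow> \<not> (\<exists>x. regular x \<and> A *v x + b \<le> x))"
proof (intro conjI impI allI)
  fix x :: "'a^'n"
  assume "Tr A \<le> 1" "regular x"
  show "A *v x + b \<le> x \<longleftrightarrow> (\<exists>u. regular u \<and> b \<le> u \<and> x = mat_star A *v u)"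
  proof
    assume "A *v x + b \<le> x"
    then have "b \<le> x" "x = mat_star A *v x"
      by (simp_all add: plus_vec_le_iff mat_star_vector_eq)
    \<comment> \<open>The witness is \<open>u = x\<close>: a solution is fixed by the star.\<close>
    with \<open>regular x\<close> show "\<exists>u. regular u \<and> b \<le> u \<and> x = mat_star A *v u"
      by blast
  next
    assume "\<exists>u. regular u \<and> b \<le> u \<and> x = mat_star A *v u"
    then obtain u where u: "b \<le> u" "x = mat_star A *v u"
      by blast
    have "b \<le> x"
      unfolding u(2) using u(1) le_mat_star_vector by (rule order_trans)
    moreover have "A *v x \<le> x"
      unfolding u(2) using \<open>Tr A \<le> 1\<close> by (rule matrix_mat_star_vector_le)
    ultimately show "A *v x + b \<le> x"
      by (simp add: plus_vec_le_iff)
  qed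
next
  assume "Tr A > 1"
  then show "\<not> (\<exists>x. regular x \<and> A *v x + b \<le> x)"
    by (auto simp: plus_vec_le_iff dest: Tr_le_one)
qed

end
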